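(* Let $T=(K \cup S, E)$ be a threshold graph, where $S$ is a maximal independent set and $K$ a minimal clique partitioning the vertices as described in the context, with $|K| = n$ and $K$ twin-free. If $n \geq 5$, then Non-Disconnecting Arc-Kayles played on $T$ has the same outcome as the subtraction game with subtraction set $\{1,2\}$ played on a single heap of size $n-1$; consequently the outcome of Non-Disconnecting Arc-Kayles on $T$ can be computed in polynomial time.
   Context: Non-Disconnecting Arc-Kayles is the two-player impartial game played on a connected finite simple graph in which the players alternate removing two adjacent vertices (and all incident edges), with the constraint that the remaining graph must be connected; the first player unable to move loses. A threshold graph is a graph that can be built from the empty graph by repeatedly adding either an isolated vertex or a universal vertex; its vertex set can be partitioned into a clique $K$ and an independent set $S$, and here the partition is chosen so that $S$ is maximal and $K$ minimal (a vertex that could be placed in either part is placed in $S$). $K$ is twin-free if no two distinct vertices of $K$ are twins, i.e., have the same neighbourhood (apart from each other). The subtraction game on $\{1,2\}$ on a heap of $m$ tokens: players alternately remove $1$ or $2$ tokens from the heap, and the player unable to move loses. *)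

theory Defs
  imports "HOL-Computational_Algebra.Polynomial"
begin

section \<open>Impartial games under normal play\<close>

text \<open>A game is given by its move relation: \<open>move x y\<close> means that \<open>y\<close> is an option of \<open>x\<close>.
  The player to move wins at \<open>x\<close> iff some option \<open>y\<close> leaves the opponent without a move or with
  moves to winning positions only.\<close>

inductive next_wins :: "('p \<Rightarrow> 'p \<Rightarrow> bool) \<Rightarrow> 'p \<Rightarrow> bool" for move where
  "move x y \<Longrightarrow> (\<And>z. move y z \<Longrightarrow> next_wins move z) \<Longrightarrow> next_wins move x"

datatype outcome = N_position | P_position

text \<open>The two cases are exhaustive in the usual sense (the next or the previous player has a
  winning strategy) for games without infinite plays, such as the two games below.\<close>

definition outcome :: "('p \<Rightarrow> 'p \<Rightarrow> bool) \<Rightarrow> 'p \<Rightarrow> outcome" where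
  "outcome move x = (if next_wins move x then N_position else P_position)"

definition subtraction_move :: "nat set \<Rightarrow> nat \<Rightarrow> nat \<Rightarrow> bool" where
  "subtraction_move D m m' \<longleftrightarrow> (\<exists>d\<in>D. d \<le> m \<and> m' = m - d)"


section \<open>Graphs\<close>

type_synonym 'a graph = "'a set \<times> 'a set set"

definition simple_graph :: "'a graph \<Rightarrow> bool" where
  "simple_graph = (\<lambda>(V, E). finite V \<and> E \<subseteq> {{u, v} | u v. u \<in> V \<and> v \<in> V \<and> u \<noteq> v})"

text \<open>The graph without vertices counts as connected, so taking the last two vertices is a legal
  move.\<close>

definition connected_graph :: "'a graph \<Rightarrow> bool" where
  "connected_graph = (\<lambda>(V, E). \<forall>u\<in>V. \<forall>v\<in>V. (u, v) \<in> {(x, y). {x, y} \<in> E}\<^sup>*)"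

definition delete_vertices :: "'a graph \<Rightarrow> 'a set \<Rightarrow> 'a graph" where
  "delete_vertices = (\<lambda>(V, E) X. (V - X, {e \<in> E. e \<inter> X = {}}))"

definition neighbours :: "'a graph \<Rightarrow> 'a \<Rightarrow> 'a set" where
  "neighbours G v = {u. {u, v} \<in> snd G}"

definition clique :: "'a graph \<Rightarrow> 'a set \<Rightarrow> bool" where
  "clique = (\<lambda>(V, E) K. K \<subseteq> V \<and> (\<forall>u\<in>K. \<forall>v\<in>K. u \<noteq> v \<longrightarrow> {u, v} \<in> E))"

definition independent :: "'a graph \<Rightarrow> 'a set \<Rightarrow> bool" where
  "independent = (\<lambda>(V, E) S. S \<subseteq> V \<and> (\<forall>u\<in>S. \<forall>v\<in>S. {u, v} \<notin> E))"

inductive threshold_graph :: "'a graph \<Rightarrow> bool" where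
  empty: "threshold_graph ({}, {})"
| isolated: "threshold_graph (V, E) \<Longrightarrow> v \<notin> V \<Longrightarrow> threshold_graph (insert v V, E)"
| universal: "threshold_graph (V, E) \<Longrightarrow> v \<notin> V \<Longrightarrow>
    threshold_graph (insert v V, E \<union> {{v, u} | u. u \<in> V})"

definition clique_independent_partition :: "'a graph \<Rightarrow> 'a set \<Rightarrow> 'a set \<Rightarrow> bool" where
  "clique_independent_partition G K S \<longleftrightarrow>
     K \<union> S = fst G \<and> K \<inter> S = {} \<and> clique G K \<and> independent G S"

text \<open>Since \<open>K\<close> and \<open>S\<close> are complementary, enlarging \<open>S\<close> is the same as shrinking \<open>K\<close>: the
  condition makes \<open>S\<close> maximal and \<open>K\<close> minimal at once.\<close>

definition maximal_partition :: "'a graph \<Rightarrow> 'a set \<Rightarrow> 'a set \<Rightarrow> bool" where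
  "maximal_partition G K S \<longleftrightarrow> clique_independent_partition G K S \<and>
     (\<forall>K' S'. clique_independent_partition G K' S' \<longrightarrow> \<not> S \<subset> S')"

definition twins :: "'a graph \<Rightarrow> 'a \<Rightarrow> 'a \<Rightarrow> bool" where
  "twins G u v \<longleftrightarrow> neighbours G u - {v} = neighbours G v - {u}"

definition twin_free :: "'a graph \<Rightarrow> 'a set \<Rightarrow> bool" where
  "twin_free G K \<longleftrightarrow> (\<forall>u\<in>K. \<forall>v\<in>K. u \<noteq> v \<longrightarrow> \<not> twins G u v)"


section \<open>Non-Disconnecting Arc-Kayles\<close>

definition ndak_move :: "'a graph \<Rightarrow> 'a graph \<Rightarrow> bool" where
  "ndak_move G H \<longleftrightarrow>
     (\<exists>u v. u \<noteq> v \<and> {u, v} \<in> snd G \<and> H = delete_vertices G {u, v} \<and> connected_graph H)"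


section \<open>Polynomial time\<close>

text \<open>Structured programs for a random access machine with registers \<open>s 0, s 1, \<dots>\<close> that hold
  natural numbers, indirect addressing (\<open>Load\<close>, \<open>Store\<close>) and a read-only, randomly accessible
  input word. Each elementary instruction and each test costs one unit. As the only arithmetic
  operations are addition and truncated subtraction, numbers have at most linearly many bits in the
  running time, so that polynomial time on this machine agrees with polynomial time on Turing
  machines.\<close>

datatype com =
    Const nat nat
  | Add nat nat nat
  | Sub nat nat nat
  | Load nat nat
  | Store nat nat
  | Len nat
  | Read nat nat
  | Seq com com
  | IfZero nat com com
  | WhileNonzero nat com

text \<open>\<open>exec w c s t s'\<close>: on input \<open>w\<close>, the program \<open>c\<close> started in state \<open>s\<close> halts after \<open>t\<close> steps
  in state \<open>s'\<close>. Reading beyond the end of the input yields 0.\<close>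

inductive exec :: "bool list \<Rightarrow> com \<Rightarrow> (nat \<Rightarrow> nat) \<Rightarrow> nat \<Rightarrow> (nat \<Rightarrow> nat) \<Rightarrow> bool" for w where
  Const: "exec w (Const i k) s 1 (s(i := k))"
| Add: "exec w (Add i j k) s 1 (s(i := s j + s k))"
| Sub: "exec w (Sub i j k) s 1 (s(i := s j - s k))"
| Load: "exec w (Load i j) s 1 (s(i := s (s j)))"
| Store: "exec w (Store i j) s 1 (s(s i := s j))"
| Len: "exec w (Len i) s 1 (s(i := length w))"
| Read: "exec w (Read i j) s 1 (s(i := (if s j < length w \<and> w ! s j then 1 else 0)))"
| Seq: "exec w c1 s t1 s1 \<Longrightarrow> exec w c2 s1 t2 s2 \<Longrightarrow> exec w (Seq c1 c2) s (t1 + t2) s2"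
| IfZero_true: "s i = 0 \<Longrightarrow> exec w c1 s t s' \<Longrightarrow> exec w (IfZero i c1 c2) s (t + 1) s'"
| IfZero_false: "s i \<noteq> 0 \<Longrightarrow> exec w c2 s t s' \<Longrightarrow> exec w (IfZero i c1 c2) s (t + 1) s'"
| While_stop: "s i = 0 \<Longrightarrow> exec w (WhileNonzero i c) s 1 s"
| While_step: "s i \<noteq> 0 \<Longrightarrow> exec w c s t1 s1 \<Longrightarrow> exec w (WhileNonzero i c) s1 t2 s2 \<Longrightarrow>
    exec w (WhileNonzero i c) s (t1 + t2 + 1) s2"

text \<open>A single program has to answer correctly, in register 0, on every instance from \<open>D\<close>; its
  behaviour on other inputs is unconstrained.\<close>

definition poly_time_computable_on :: "('i \<Rightarrow> bool list) \<Rightarrow> 'i set \<Rightarrow> ('i \<Rightarrow> nat) \<Rightarrow> bool" where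
  "poly_time_computable_on enc D f \<longleftrightarrow>
     (\<exists>c (p :: nat poly). \<forall>x\<in>D. \<exists>t s.
        exec (enc x) c (\<lambda>_. 0) t s \<and> s 0 = f x \<and> t \<le> poly p (length (enc x)))"

text \<open>The adjacency matrix, row by row, of a graph with vertex set \<open>{0..<N}\<close>.\<close>

definition adjacency_matrix :: "nat graph \<Rightarrow> bool list" where
  "adjacency_matrix G =
     (let N = card (fst G) in [{i, j} \<in> snd G. i \<leftarrow> [0..<N], j \<leftarrow> [0..<N]])"

fun outcome_code :: "outcome \<Rightarrow> nat" where
  "outcome_code N_position = 1"
| "outcome_code P_position = 0"


section \<open>The class of graphs considered\<close>

text \<open>The connectedness requirement comes from the game, which is only played on connected
  graphs.\<close>

definition twin_free_threshold_graph :: "'a graph \<Rightarrow> 'a set \<Rightarrow> 'a set \<Rightarrow> bool" where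
  "twin_free_threshold_graph T K S \<longleftrightarrow>
     simple_graph T \<and> connected_graph T \<and> threshold_graph T \<and>
     maximal_partition T K S \<and> twin_free T K"

end

(* The vertices of K have pairwise distinct, nested, nonempty neighbourhoods in S, and one of them
   sees all of S. Among positions of this shape, those with |K| congruent to 1 modulo 3 (and
   |S| >= 3 if |K| = 1) are lost for the player to move: every move can be answered so that |K| has dropped by exactly 3 and the
   shape is restored. A move within K is answered by removing the lowest vertex of K together with
   a neighbour of it in S. After a move that removes s from S, two neighbourhoods may have become
   equal, or one empty, and removing one suitable vertex of K repairs this; the answer
   removes that vertex and another one from K. From the other residues, if |K| >= 5, there is a
   move to a lost position.

   For the running time, it suffices to compute |K|, and |K| is the number of t with 1 <= t such
   that more than t vertices have degree at least t. *)
theory Submission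
  imports Defs
begin

section \<open>Losing strategies and the subtraction game\<close>

text \<open>Strong induction on \<open>n\<close>, a measure that bounds the rest of the play. The
  reply to \<open>y\<close> reaches a smaller position in \<open>L\<close>: all its options win, so
  \<open>y\<close> wins, and it does not win itself, so moving to \<open>y\<close> is no winning
  move.\<close>

lemma losing_strategy:
  assumes reply: "\<And>n x y. L n x \<Longrightarrow> move x y \<Longrightarrow> \<exists>k<n. \<exists>z. L k z \<and> move y z"
    and "L (n :: nat) x"
  shows "move x y \<Longrightarrow> next_wins move y" and "\<not> next_wins move x"
proof -
  have *: "(\<forall>y. move x y \<longrightarrow> next_wins move y) \<and> \<not> next_wins move x"
    using assms(2)
  proof (induction n arbitrary: x rule: less_induct)
    case (less n)
    have answer: "\<exists>z. move y z \<and> (\<forall>y'. move z y' \<longrightarrow> next_wins move y') \<and> \<not> next_wins move z"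
      if "move x y" for y
      using reply[OF less.prems that] less.IH by blast
    then have "next_wins move y" if "move x y" for y
      using that next_wins.intros[of move y] by blast
    moreover have "\<not> next_wins move x"
    proof
      assume "next_wins move x"
      then obtain y where "move x y" "\<forall>z. move y z \<longrightarrow> next_wins move z"
        by (auto elim: next_wins.cases)
      then show False using answer by blast
    qed
    ultimately show ?case by blast
  qed
  then show "move x y \<Longrightarrow> next_wins move y" "\<not> next_wins move x" by blast+
qed

text \<open>A heap divisible by 3 is lost because taking \<open>d\<close> tokens is answered by
  taking \<open>3 - d\<close>; from any other heap, taking \<open>m mod 3\<close> tokens reaches
  such a heap.\<close>

lemma next_wins_subtraction_12: "next_wins (subtraction_move {1, 2}) m \<longleftrightarrow> m mod 3 \<noteq> 0"
proof -
  have moves: "subtraction_move {1, 2} m m' \<longleftrightarrow> m = m' + 1 \<or> m = m' + 2" for m m'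
    by (auto simp: subtraction_move_def)
  have lost: "subtraction_move {1, 2} n x \<Longrightarrow> next_wins (subtraction_move {1, 2}) x"
    "\<not> next_wins (subtraction_move {1, 2}) n" if n: "n mod 3 = 0" for n x
  proof -
    have "\<exists>k<n. \<exists>z. (z = k \<and> k mod 3 = 0) \<and> subtraction_move {1, 2} y z"
      if L: "x = n \<and> n mod 3 = 0" and move: "subtraction_move {1, 2} x y" for n x y :: nat
    proof -
      have y: "n = y + 1 \<or> n = y + 2" and n: "n mod 3 = 0" using L move unfolding moves by auto
      have "n \<ge> 3"
      proof (rule ccontr)
        assume "\<not> n \<ge> 3"
        then have "n mod 3 = n" by simp
        then show False using n y by linarith
      qed
      then obtain z where "n = z + 3" by (metis add.commute le_Suc_ex)
      then show ?thesis using y n unfolding moves by (intro exI[of _ z]) auto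
    qed
    note strategy = losing_strategy[where L = "\<lambda>n x. x = n \<and> n mod 3 = 0" and n = n and x = n, OF this]
    show "subtraction_move {1, 2} n x \<Longrightarrow> next_wins (subtraction_move {1, 2}) x"
      using n by (intro strategy(1)) auto
    show "\<not> next_wins (subtraction_move {1, 2}) n"
      using n by (intro strategy(2)) auto
  qed
  show ?thesis
  proof (cases "m mod 3 = 0")
    case True
    then show ?thesis using lost(2) by simp
  next
    case False
    define y where "y = 3 * (m div 3)"
    have "m = y + m mod 3" "m mod 3 < 3" by (simp_all add: y_def)
    then have "m = y + 1 \<or> m = y + 2" using False by linarith
    then have "subtraction_move {1, 2} m y" unfolding moves .
    moreover have "next_wins (subtraction_move {1, 2}) z" if "subtraction_move {1, 2} y z" for z
      using lost(1)[OF _ that] by (simp add: y_def)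
    ultimately have "next_wins (subtraction_move {1, 2}) m" by (rule next_wins.intros)
    then show ?thesis using False by simp
  qed
qed

section \<open>Split graphs with nested neighbourhoods\<close>

text \<open>The map \<open>f\<close> stays fixed during play and only \<open>A\<close> and
  \<open>B\<close> shrink. Hence \<open>f a\<close> may contain vertices outside \<open>B\<close>,
  and only the trace \<open>f a \<inter> B\<close> counts.\<close>

definition split_graph :: "('a \<Rightarrow> 'a set) \<Rightarrow> 'a set \<Rightarrow> 'a set \<Rightarrow> 'a graph" where
  "split_graph f A B = (A \<union> B, {{a, b} | a b. a \<in> A \<and> b \<in> A \<and> a \<noteq> b} \<union>
                               {{a, s} | a s. a \<in> A \<and> s \<in> B \<and> s \<in> f a})"

lemma fst_split_graph [simp]: "fst (split_graph f A B) = A \<union> B"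
  by (simp add: split_graph_def)

lemma edge_split_graph_iff:
  assumes "A \<inter> B = {}"
  shows "{u, v} \<in> snd (split_graph f A B) \<longleftrightarrow>
    u \<in> A \<and> v \<in> A \<and> u \<noteq> v \<or> u \<in> A \<and> v \<in> B \<and> v \<in> f u \<or> v \<in> A \<and> u \<in> B \<and> u \<in> f v"
  using assms by (auto simp: split_graph_def doubleton_eq_iff)

lemma delete_vertices_split_graph:
  "delete_vertices (split_graph f A B) X = split_graph f (A - X) (B - X)"
proof -
  let ?P = "{{a, b} | a b. a \<in> A \<and> b \<in> A \<and> a \<noteq> b}"
  let ?Q = "{{a, s} | a s. a \<in> A \<and> s \<in> B \<and> s \<in> f a}"
  have "{e \<in> ?P \<union> ?Q. e \<inter> X = {}} = {e \<in> ?P. e \<inter> X = {}} \<union> {e \<in> ?Q. e \<inter> X = {}}" by blast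
  also have "{e \<in> ?P. e \<inter> X = {}} = {{a, b} | a b. a \<in> A - X \<and> b \<in> A - X \<and> a \<noteq> b}" by blast
  also have "{e \<in> ?Q. e \<inter> X = {}} = {{a, s} | a s. a \<in> A - X \<and> s \<in> B - X \<and> s \<in> f a}" by blast
  finally show ?thesis
    by (simp only: delete_vertices_def split_graph_def prod.case Un_Diff)
qed

text \<open>\<open>u\<close> is adjacent to every other vertex, so it links any two
  vertices.\<close>

lemma connected_split_graphI:
  assumes disj: "A \<inter> B = {}" and u: "u \<in> A" "B \<subseteq> f u"
  shows "connected_graph (split_graph f A B)"
proof -
  let ?G = "split_graph f A B"
  let ?R = "{(x, y). {x, y} \<in> snd ?G}"
  have to_u: "(v, u) \<in> ?R\<^sup>*" "(u, v) \<in> ?R\<^sup>*" if "v \<in> A \<union> B" for v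
  proof -
    have "v = u \<or> {v, u} \<in> snd ?G \<and> {u, v} \<in> snd ?G"
      using that u by (auto simp: edge_split_graph_iff[OF disj])
    then show "(v, u) \<in> ?R\<^sup>*" "(u, v) \<in> ?R\<^sup>*" by auto
  qed
  have "(v, w) \<in> ?R\<^sup>*" if "v \<in> A \<union> B" "w \<in> A \<union> B" for v w
    using to_u(1)[OF that(1)] to_u(2)[OF that(2)] by (rule rtrancl_trans)
  then show ?thesis
    unfolding connected_graph_def case_prod_unfold by simp
qed

lemma connected_graph_neighbour:
  assumes "connected_graph G" "u \<in> fst G" "v \<in> fst G" "u \<noteq> v"
  obtains w where "{w, u} \<in> snd G"
proof -
  have "(v, u) \<in> {(x, y). {x, y} \<in> snd G}\<^sup>*"
    using assms by (auto simp: connected_graph_def split: prod.splits)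
  with \<open>u \<noteq> v\<close> obtain w where "{w, u} \<in> snd G"
    by (auto elim: rtranclE)
  then show ?thesis by (rule that)
qed

definition nested :: "('a \<Rightarrow> 'a set) \<Rightarrow> 'a set \<Rightarrow> 'a set \<Rightarrow> bool" where
  "nested f A B \<longleftrightarrow> (\<forall>a\<in>A. \<forall>b\<in>A. f a \<inter> B \<subseteq> f b \<or> f b \<inter> B \<subseteq> f a)"

text \<open>Nonempty traces reflect that no vertex of \<open>A\<close> could join \<open>B\<close>,
  strictness of the chain that \<open>A\<close> is twin-free.\<close>

definition strictly_nested :: "('a \<Rightarrow> 'a set) \<Rightarrow> 'a set \<Rightarrow> 'a set \<Rightarrow> bool" where
  "strictly_nested f A B \<longleftrightarrow> (\<forall>a\<in>A. f a \<inter> B \<noteq> {}) \<and>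
     (\<forall>a\<in>A. \<forall>b\<in>A. a \<noteq> b \<longrightarrow> f a \<inter> B \<subset> f b \<inter> B \<or> f b \<inter> B \<subset> f a \<inter> B)"

lemma strictly_nested_imp_nested: "strictly_nested f A B \<Longrightarrow> nested f A B"
  unfolding strictly_nested_def nested_def by (metis Int_subset_iff order_refl psubsetE)

lemma nested_mono: "nested f A B \<Longrightarrow> A' \<subseteq> A \<Longrightarrow> B' \<subseteq> B \<Longrightarrow> nested f A' B'"
  unfolding nested_def by blast

lemma strictly_nested_subset: "strictly_nested f A B \<Longrightarrow> A' \<subseteq> A \<Longrightarrow> strictly_nested f A' B"
  unfolding strictly_nested_def by blast

lemma nested_greatest:
  assumes "nested f A B" "finite A" "A \<noteq> {}"
  obtains u where "u \<in> A" "\<And>a. a \<in> A \<Longrightarrow> f a \<inter> B \<subseteq> f u"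
proof -
  have "\<exists>u\<in>A. \<forall>a\<in>A. f a \<inter> B \<subseteq> f u"
    using assms(2,3,1)
  proof (induction A rule: finite_ne_induct)
    case (singleton x)
    then show ?case by simp
  next
    case (insert x F)
    then obtain u where u: "u \<in> F" "\<forall>a\<in>F. f a \<inter> B \<subseteq> f u"
      by (meson nested_mono subset_insertI order_refl)
    have "f x \<inter> B \<subseteq> f u \<or> f u \<inter> B \<subseteq> f x"
      using insert.prems u(1) by (simp add: nested_def)
    then show ?case using u by blast
  qed
  then show ?thesis using that by blast
qed

text \<open>Complementing the neighbourhoods reverses the chain, which reduces the claim to
  \<open>nested_greatest\<close>.\<close>

lemma nested_least:
  assumes "nested f A B" "finite A" "A \<noteq> {}"
  obtains u where "u \<in> A" "\<And>a. a \<in> A \<Longrightarrow> f u \<inter> B \<subseteq> f a"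
proof -
  have "nested (\<lambda>a. - f a) A B" using assms(1) unfolding nested_def by blast
  then obtain u where "u \<in> A" "\<And>a. a \<in> A \<Longrightarrow> - f a \<inter> B \<subseteq> - f u"
    using nested_greatest assms(2,3) by blast
  then show ?thesis by (intro that[of u]) blast+
qed

text \<open>A converse of \<open>connected_split_graphI\<close> for nested neighbourhoods: every
  vertex of \<open>B\<close> has a neighbour, which must lie in \<open>A\<close>, and the greatest
  trace contains the trace of that neighbour.\<close>

lemma connected_split_graph_cover:
  assumes con: "connected_graph (split_graph f A B)" and disj: "A \<inter> B = {}"
    and nest: "nested f A B" and A: "finite A" "A \<noteq> {}"
  obtains u where "u \<in> A" "B \<subseteq> f u"
proof -
  obtain u where u: "u \<in> A" "\<And>a. a \<in> A \<Longrightarrow> f a \<inter> B \<subseteq> f u"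
    using nested_greatest[OF nest A] by blast
  have "s \<in> f u" if s: "s \<in> B" for s
  proof -
    have "s \<noteq> u" using disj s u(1) by blast
    then obtain w where "{w, s} \<in> snd (split_graph f A B)"
      using connected_graph_neighbour[OF con, of s u] s u(1) by auto
    then have "w \<in> A \<and> s \<in> f w" using disj s by (auto simp: edge_split_graph_iff)
    then show ?thesis using u(2) s by blast
  qed
  then show ?thesis using u(1) that by blast
qed

section \<open>Positions and the moves that preserve their shape\<close>

text \<open>The covering vertex \<open>u\<close> stands for connectedness; for nested neighbourhoods
  and nonempty \<open>A\<close> the two are equivalent.\<close>

definition position :: "('a \<Rightarrow> 'a set) \<Rightarrow> 'a set \<Rightarrow> 'a set \<Rightarrow> bool" where
  "position f A B \<longleftrightarrow> finite A \<and> finite B \<and> A \<inter> B = {} \<and> strictly_nested f A B \<and>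
     (\<exists>u\<in>A. B \<subseteq> f u)"

text \<open>Legality is witnessed by a covering vertex \<open>u\<close> that is not removed.
  \<open>A'\<close> and \<open>B'\<close> are tied by equations so that the rule also applies when
  the removed pair misses \<open>B\<close>.\<close>

lemma ndak_moveI:
  assumes "A \<inter> B = {}" "{v, w} \<in> snd (split_graph f A B)" "v \<noteq> w" "u \<in> A - {v, w}" "B \<subseteq> f u"
    "A' = A - {v, w}" "B' = B - {v, w}"
  shows "ndak_move (split_graph f A B) (split_graph f A' B')"
proof -
  have "connected_graph (split_graph f A' B')"
    using assms by (intro connected_split_graphI[of _ _ u]) auto
  then show ?thesis
    unfolding ndak_move_def using assms by (auto simp: delete_vertices_split_graph)
qed

text \<open>The vertex \<open>v\<close> is prescribed, since in \<open>lost_reply\<close> it is the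
  one whose removal repairs the chain; its partner \<open>w\<close> is any third vertex, so that the
  cover \<open>u\<close> survives.\<close>

lemma ndak_move_clique_pair:
  assumes disj: "A \<inter> B = {}" and fin: "finite A" and u: "u \<in> A" "B \<subseteq> f u"
    and v: "v \<in> A" "v \<noteq> u" and A: "card A \<ge> 3"
  obtains w where "w \<in> A" "w \<noteq> u" "w \<noteq> v"
    "ndak_move (split_graph f A B) (split_graph f (A - {v, w}) B)"
proof -
  have "card {u, v} < card A" using A v(2) by simp
  then have "\<not> A \<subseteq> {u, v}" by (meson card_mono finite.emptyI finite_insert leD)
  then obtain w where w: "w \<in> A" "w \<noteq> u" "w \<noteq> v" by blast
  have "ndak_move (split_graph f A B) (split_graph f (A - {v, w}) B)"
    by (rule ndak_moveI[where u = u and v = v and w = w])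
      (use disj u v w in \<open>auto simp: edge_split_graph_iff\<close>)
  then show ?thesis using that w by blast
qed

text \<open>Removing clique vertices does not change the traces of the others, so the shape survives
  if the covering vertex is kept.\<close>

lemma position_remove_clique_pair:
  assumes "position f A B" "card A \<ge> 3"
  obtains A' where "position f A' B" "card A' = card A - 2"
    "ndak_move (split_graph f A B) (split_graph f A' B)"
proof -
  from assms(1) obtain u where u: "u \<in> A" "B \<subseteq> f u" and fin: "finite A" "finite B"
    and disj: "A \<inter> B = {}" and nest: "strictly_nested f A B" by (auto simp: position_def)
  have "\<not> A \<subseteq> {u}" using assms(2) card_mono[of "{u}" A] by auto
  then obtain v where v: "v \<in> A" "v \<noteq> u" by blast
  obtain w where w: "w \<in> A" "w \<noteq> u" "w \<noteq> v"
    "ndak_move (split_graph f A B) (split_graph f (A - {v, w}) B)"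
    using ndak_move_clique_pair[where u = u and f = f, OF disj fin(1) u v assms(2)] by blast
  have "position f (A - {v, w}) B"
    using u w fin disj v strictly_nested_subset[OF nest, of "A - {v, w}"] by (auto simp: position_def)
  moreover have "card (A - {v, w}) = card A - 2"
    using v w fin by (simp add: card_Diff_subset)
  ultimately show ?thesis using that w by blast
qed

text \<open>A neighbour \<open>s\<close> of the lowest clique vertex \<open>x\<close> lies in every
  trace, so its removal keeps all inclusions strict. The remaining traces properly contain that of
  \<open>x\<close>, hence stay nonempty without \<open>s\<close>.\<close>

lemma position_remove_least:
  assumes "position f A B" "card A \<ge> 2"
  obtains A' B' where "position f A' B'" "card A' = card A - 1" "card B' = card B - 1"
    "ndak_move (split_graph f A B) (split_graph f A' B')"
proof -
  from assms(1) obtain u where u: "u \<in> A" "B \<subseteq> f u" and fin: "finite A" "finite B"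
    and disj: "A \<inter> B = {}" and nest: "strictly_nested f A B" by (auto simp: position_def)
  obtain x where x: "x \<in> A" "\<And>a. a \<in> A \<Longrightarrow> f x \<inter> B \<subseteq> f a"
    using nested_least[OF strictly_nested_imp_nested[OF nest] fin(1)] u(1) by blast
  obtain s where s: "s \<in> B" "s \<in> f x" using nest x(1) unfolding strictly_nested_def by blast
  have above: "f x \<inter> B \<subset> f a \<inter> B" if "a \<in> A" "a \<noteq> x" for a
    using nest x that unfolding strictly_nested_def by blast
  \<comment> \<open>If the least trace were all of \<open>B\<close>, no second trace could lie
    properly above it.\<close>
  have "x \<noteq> u"
  proof
    assume "x = u"
    then have "A \<subseteq> {u}" using above u(2) by blast
    then show False using assms(2) card_mono[of "{u}" A] by auto
  qed
  have sA: "s \<notin> A" "x \<notin> B" using disj s x by auto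
  have "strictly_nested f (A - {x}) (B - {s})"
    unfolding strictly_nested_def
  proof (intro conjI ballI impI)
    fix a assume "a \<in> A - {x}"
    then show "f a \<inter> (B - {s}) \<noteq> {}" using above[of a] s by auto
  next
    fix a b assume a: "a \<in> A - {x}" and b: "b \<in> A - {x}" and "a \<noteq> b"
    then have "f a \<inter> B \<subset> f b \<inter> B \<or> f b \<inter> B \<subset> f a \<inter> B" using nest
      unfolding strictly_nested_def by blast
    moreover have "s \<in> f a" "s \<in> f b" using above[of a] above[of b] a b s by auto
    ultimately show "f a \<inter> (B - {s}) \<subset> f b \<inter> (B - {s}) \<or> f b \<inter> (B - {s}) \<subset> f a \<inter> (B - {s})"
      by blast
  qed
  then have "position f (A - {x}) (B - {s})"
    using u fin disj \<open>x \<noteq> u\<close> by (auto simp: position_def)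
  moreover have "ndak_move (split_graph f A B) (split_graph f (A - {x}) (B - {s}))"
    by (rule ndak_moveI[where u = u and v = x and w = s])
      (use disj u x s sA \<open>x \<noteq> u\<close> in \<open>auto simp: edge_split_graph_iff\<close>)
  ultimately show ?thesis using that x s fin by (simp add: card_Diff_singleton)
qed

text \<open>Removing \<open>s\<close> changes only the traces that contain \<open>s\<close>, and
  these form the upper end of the chain. Only the lowest of them can become empty or coincide with
  the trace just below, so dropping one vertex suffices. That vertex must differ from the cover
  \<open>u\<close>.\<close>

lemma strictly_nested_repair:
  assumes nest: "strictly_nested f A B" and fin: "finite A" and u: "u \<in> A" "B - {s} \<subseteq> f u"
    and A: "card A \<ge> 2"
  obtains y where "y \<in> A" "y \<noteq> u" "strictly_nested f (A - {y}) (B - {s})"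
proof -
  have ne: "A - {u} \<noteq> {}"
    using A card_mono[of "{u}" A] by auto
  have nest': "nested f X B" if "X \<subseteq> A" for X
    using nested_mono[OF strictly_nested_imp_nested[OF nest] that order_refl] .
  define D where "D = {a \<in> A. s \<in> f a}"
  show ?thesis
  proof (cases "s \<notin> B \<or> D = {}")
    case True
    then have "f a \<inter> (B - {s}) = f a \<inter> B" if "a \<in> A" for a using that by (auto simp: D_def)
    then have "strictly_nested f A (B - {s})" using nest by (simp add: strictly_nested_def)
    then show ?thesis using ne that strictly_nested_subset by (metis Diff_iff Diff_subset equals0I singletonI)
  next
    case False
    then have sB: "s \<in> B" and D: "D \<noteq> {}" by auto
    obtain x where x: "x \<in> D" "\<And>a. a \<in> D \<Longrightarrow> f x \<inter> B \<subseteq> f a"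
      using nested_least[of f D B] nest'[of D] fin D by (auto simp: D_def)
    have xA: "x \<in> A" "s \<in> f x" using x by (auto simp: D_def)
    have above: "f x \<inter> B \<subset> f a \<inter> B" if "a \<in> D" "a \<noteq> x" for a
      using nest x that unfolding strictly_nested_def D_def by blast
    have low: "f a \<inter> B \<subset> f x \<inter> B" if "a \<in> A" "a \<notin> D" for a
    proof -
      have "s \<notin> f a" using that by (simp add: D_def)
      then have "a \<noteq> x" using xA by blast
      then have "f a \<inter> B \<subset> f x \<inter> B \<or> f x \<inter> B \<subset> f a \<inter> B"
        using nest xA(1) that(1) unfolding strictly_nested_def by blast
      then show ?thesis using \<open>s \<notin> f a\<close> xA(2) sB by blast
    qed
    show ?thesis
    proof (cases "x = u")
      case False
      have "strictly_nested f (A - {x}) (B - {s})"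
        unfolding strictly_nested_def
      proof (intro conjI ballI impI)
        fix a assume a: "a \<in> A - {x}"
        show "f a \<inter> (B - {s}) \<noteq> {}"
        proof (cases "a \<in> D")
          case True
          then show ?thesis using above[of a] a xA sB by auto
        next
          case False
          moreover have "f a \<inter> B \<noteq> {}" using nest a by (auto simp: strictly_nested_def)
          ultimately show ?thesis using a by (auto simp: D_def)
        qed
      next
        fix a b assume a: "a \<in> A - {x}" and b: "b \<in> A - {x}" and "a \<noteq> b"
        then have lt: "f a \<inter> B \<subset> f b \<inter> B \<or> f b \<inter> B \<subset> f a \<inter> B" using nest
          unfolding strictly_nested_def by blast
        \<comment> \<open>The trace of \<open>d\<close> has an element outside that of
          \<open>x\<close>. It differs from \<open>s\<close>, which \<open>x\<close> sees, and lies
          outside the smaller trace of \<open>c\<close>, so the inclusion stays strict without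
          \<open>s\<close>.\<close>
        have xab: "f c \<inter> (B - {s}) \<subset> f d \<inter> (B - {s})" if c: "c \<in> A" "c \<notin> D" and d: "d \<in> D" "d \<noteq> x" for c d
          using low[OF c] above[OF d] xA c(2) sB c(1) unfolding D_def by blast
        show "f a \<inter> (B - {s}) \<subset> f b \<inter> (B - {s}) \<or> f b \<inter> (B - {s}) \<subset> f a \<inter> (B - {s})"
        proof (cases "a \<in> D \<longleftrightarrow> b \<in> D")
          case True
          then have "s \<in> f a \<longleftrightarrow> s \<in> f b" using a b by (simp add: D_def)
          then show ?thesis using lt by blast
        next
          case False
          then show ?thesis using xab[of a b] xab[of b a] a b by auto
        qed
      qed
      then show ?thesis using that xA False by blast
    next
      case True
      \<comment> \<open>Here the vertex to drop would be the cover itself. Then \<open>u\<close>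
        alone sees \<open>s\<close>, and it can only coincide with the next lower vertex
        \<open>y\<close>, so \<open>y\<close> is dropped instead.\<close>
      have top: "f u \<inter> (B - {s}) = B - {s}" using u(2) by blast
      have DA: "D = {u}"
      proof -
        have "B \<subseteq> f u" using u(2) xA True by blast
        then have "a = u" if "a \<in> D" for a using above[OF that] True by blast
        then show ?thesis using x(1) True by blast
      qed
      obtain y where y: "y \<in> A - {u}" "\<And>a. a \<in> A - {u} \<Longrightarrow> f a \<inter> B \<subseteq> f y"
        using nested_greatest[of f "A - {u}" B] nest'[of "A - {u}"] fin ne by auto
      have ny: "s \<notin> f a" if "a \<in> A" "a \<noteq> u" for a using that DA by (auto simp: D_def)
      have lty: "f a \<inter> B \<subset> f y \<inter> B" if "a \<in> A" "a \<noteq> u" "a \<noteq> y" for a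
        using nest y that unfolding strictly_nested_def by blast
      have "strictly_nested f (A - {y}) (B - {s})"
        unfolding strictly_nested_def
      proof (intro conjI ballI impI)
        fix a assume a: "a \<in> A - {y}"
        \<comment> \<open>The dropped vertex \<open>y\<close> still shows that
          \<open>B - {s}\<close>, the new trace of \<open>u\<close>, is nonempty.\<close>
        have "f y \<inter> B \<noteq> {}" using nest y by (auto simp: strictly_nested_def)
        then have "B - {s} \<noteq> {}" using ny[of y] y(1) by auto
        moreover have "f a \<inter> (B - {s}) \<noteq> {}" if "a \<noteq> u"
          using nest a ny[of a] that unfolding strictly_nested_def by blast
        ultimately show "f a \<inter> (B - {s}) \<noteq> {}" using top by auto
      next
        fix a b assume a: "a \<in> A - {y}" and b: "b \<in> A - {y}" and "a \<noteq> b"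
        have below_u: "f c \<inter> (B - {s}) \<subset> f u \<inter> (B - {s})" if "c \<in> A - {y}" "c \<noteq> u" for c
          using lty[of c] ny[of y] y(1) that unfolding top by blast
        show "f a \<inter> (B - {s}) \<subset> f b \<inter> (B - {s}) \<or> f b \<inter> (B - {s}) \<subset> f a \<inter> (B - {s})"
        proof (cases "a = u \<or> b = u")
          case True
          then show ?thesis
          proof
            assume "a = u"
            then have "f b \<inter> (B - {s}) \<subset> f a \<inter> (B - {s})"
              using below_u[OF b] \<open>a \<noteq> b\<close> by simp
            then show ?thesis ..
          next
            assume "b = u"
            then have "f a \<inter> (B - {s}) \<subset> f b \<inter> (B - {s})"
              using below_u[OF a] \<open>a \<noteq> b\<close> by simp
            then show ?thesis ..
          qed
        next
          case False
          then have "f a \<inter> B \<subset> f b \<inter> B \<or> f b \<inter> B \<subset> f a \<inter> B" using nest a b \<open>a \<noteq> b\<close>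
            unfolding strictly_nested_def by blast
          then show ?thesis using ny[of a] ny[of b] a b False by blast
        qed
      qed
      then show ?thesis using that y by blast
    qed
  qed
qed

section \<open>The lost positions\<close>

text \<open>For \<open>card A = 1\<close> the graph is a star. With one or two leaves, taking the
  centre and a leaf is legal and ends the game, so the player to move wins; with three or more
  leaves every move disconnects.\<close>

definition lost :: "('a \<Rightarrow> 'a set) \<Rightarrow> 'a set \<Rightarrow> 'a set \<Rightarrow> bool" where
  "lost f A B \<longleftrightarrow> position f A B \<and> card A mod 3 = 1 \<and> (card A = 1 \<longrightarrow> card B \<ge> 3)"

text \<open>The traces have distinct sizes between 1 and \<open>card B\<close>. This supplies the
  three leaves that \<open>lost\<close> demands when a clique of four vertices shrinks to
  one.\<close>

lemma position_card_le:
  assumes "position f A B"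
  shows "card A \<le> card B"
proof -
  from assms have fin: "finite A" "finite B" and nest: "strictly_nested f A B"
    by (auto simp: position_def)
  have "inj_on (\<lambda>a. card (f a \<inter> B)) A"
  proof (rule inj_onI)
    fix a b assume ab: "a \<in> A" "b \<in> A" "card (f a \<inter> B) = card (f b \<inter> B)"
    show "a = b"
    proof (rule ccontr)
      assume "a \<noteq> b"
      then have "f a \<inter> B \<subset> f b \<inter> B \<or> f b \<inter> B \<subset> f a \<inter> B"
        using nest ab unfolding strictly_nested_def by blast
      then show False using ab(3) psubset_card_mono[of "f b \<inter> B" "f a \<inter> B"]
          psubset_card_mono[of "f a \<inter> B" "f b \<inter> B"] fin by auto
    qed
  qed
  moreover have "(\<lambda>a. card (f a \<inter> B)) ` A \<subseteq> {1..card B}"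
  proof -
    have "card (f a \<inter> B) \<noteq> 0" "card (f a \<inter> B) \<le> card B" if "a \<in> A" for a
      using nest that fin by (auto simp: strictly_nested_def card_mono)
    then show ?thesis by (auto simp: Suc_le_eq)
  qed
  ultimately show ?thesis using card_inj_on_le[of _ A "{1..card B}"] by auto
qed

text \<open>Legality of the given move enters through the connectedness of \<open>H\<close>: it
  yields a vertex that covers what is left of \<open>B\<close>, and the reply keeps that
  vertex.\<close>

lemma lost_reply:
  assumes "lost f A B" and mv: "ndak_move (split_graph f A B) H"
  obtains A' B' where "lost f A' B'" "card A' < card A" "ndak_move H (split_graph f A' B')"
proof -
  from assms(1) have pos: "position f A B" and m: "card A mod 3 = 1" and
    one: "card A = 1 \<Longrightarrow> card B \<ge> 3" by (auto simp: lost_def)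
  from pos obtain u where u: "u \<in> A" "B \<subseteq> f u" and fin: "finite A" "finite B"
    and disj: "A \<inter> B = {}" and nest: "strictly_nested f A B" by (auto simp: position_def)
  from mv obtain v w where vw: "v \<noteq> w" "{v, w} \<in> snd (split_graph f A B)"
    and H: "H = split_graph f (A - {v, w}) (B - {v, w})" and con: "connected_graph H"
    unfolding ndak_move_def by (auto simp: delete_vertices_split_graph)
  have "\<exists>A' B'. lost f A' B' \<and> card A' < card A \<and> ndak_move H (split_graph f A' B')"
  proof (cases "v \<in> A \<and> w \<in> A")
    case True
    \<comment> \<open>\<open>A\<close> has at least two vertices, and the sizes 2 and 3 have the
      wrong residue.\<close>
    have "card A \<ge> card {v, w}" using True fin by (intro card_mono) auto
    then have A4: "card A \<ge> 4" using m vw(1) by (simp; presburger)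
    have cA: "card (A - {v, w}) = card A - 2" using True vw(1) fin by (simp add: card_Diff_subset)
    have BH: "B - {v, w} = B" using True disj by auto
    have "card (A - {v, w}) \<noteq> 0" using A4 cA by simp
    then have "A - {v, w} \<noteq> {}" by (metis card.empty)
    moreover have sub: "strictly_nested f (A - {v, w}) B" using strictly_nested_subset[OF nest] by auto
    ultimately obtain u' where "u' \<in> A - {v, w}" "B \<subseteq> f u'"
      using connected_split_graph_cover[of f "A - {v, w}" B] con H BH disj fin
        strictly_nested_imp_nested by (metis Diff_disjoint finite_Diff inf.commute Int_Diff empty_Diff)
    then have "position f (A - {v, w}) B" using fin disj sub by (auto simp: position_def)
    then obtain A' B' where *: "position f A' B'" "card A' = card (A - {v, w}) - 1"
      "card B' = card B - 1" "ndak_move (split_graph f (A - {v, w}) B) (split_graph f A' B')"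
    proof (rule position_remove_least)
      show "card (A - {v, w}) \<ge> 2" using A4 cA by simp
    qed
    have "card A' = card A - 3" using * cA by simp
    moreover have "card A' mod 3 = 1"
      using m A4 \<open>card A' = card A - 3\<close> le_mod_geq[of 3 "card A"] by simp
    moreover have "card B' \<ge> 3" using *(3) position_card_le[OF pos] A4 by simp
    ultimately have "lost f A' B'" "card A' < card A" using *(1) A4 by (simp_all add: lost_def)
    moreover have "ndak_move H (split_graph f A' B')" using *(4) H BH by simp
    ultimately show ?thesis by blast
  next
    case False
    then obtain k s where ks: "{v, w} = {k, s}" "k \<in> A" "s \<in> B" "s \<in> f k"
      using vw(2) unfolding edge_split_graph_iff[OF disj] by blast
    define A1 where "A1 = A - {k}"
    define B1 where "B1 = B - {s}"
    have H1: "H = split_graph f A1 B1"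
    proof -
      have "A - {k, s} = A1" "B - {k, s} = B1" using ks disj by (auto simp: A1_def B1_def)
      then show ?thesis using H ks(1) by simp
    qed
    have c1: "card A1 = card A - 1" "card B1 = card B - 1"
      using ks fin by (auto simp: A1_def B1_def)
    \<comment> \<open>Otherwise the position was a star with at least three leaves, and
      \<open>H\<close> would consist of two or more isolated vertices.\<close>
    have "A1 \<noteq> {}"
    proof
      assume e: "A1 = {}"
      then have "card A = 1" using c1 ks(2) fin by (metis A1_def Diff_eq_empty_iff card_1_singleton_iff subset_singletonD One_nat_def empty_iff)
      then have B2: "card B1 \<ge> 2" using one c1 by simp
      then obtain a b where ab: "a \<in> B1" "b \<in> B1" "a \<noteq> b"
        by (metis card_2_iff' obtain_subset_with_card_n subset_iff)
      obtain c where "{c, a} \<in> snd H"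
        using connected_graph_neighbour[OF con, of a b] ab H1 by auto
      then show False using e by (simp add: H1 edge_split_graph_iff)
    qed
    have "card A1 \<noteq> 0" using \<open>A1 \<noteq> {}\<close> fin by (simp add: A1_def)
    then have "card A \<noteq> 0" "card A \<noteq> 1" "card A \<noteq> 2" "card A \<noteq> 3" using m c1 by auto
    then have A4: "card A \<ge> 4" by linarith
    have nest1: "strictly_nested f A1 B" using strictly_nested_subset[OF nest] by (auto simp: A1_def)
    have disj1: "A1 \<inter> B1 = {}" using disj by (auto simp: A1_def B1_def)
    have fin1: "finite A1" "finite B1" using fin by (auto simp: A1_def B1_def)
    have "nested f A1 B1"
      by (rule nested_mono[OF strictly_nested_imp_nested[OF nest1]]) (auto simp: B1_def)
    then obtain u' where u': "u' \<in> A1" "B1 \<subseteq> f u'"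
      using connected_split_graph_cover[of f A1 B1] con H1 disj1 fin1 \<open>A1 \<noteq> {}\<close> by blast
    have A1: "card A1 \<ge> 2" "card A1 \<ge> 3" using A4 c1 by auto
    \<comment> \<open>The traces are known to be strictly nested on \<open>B\<close>; losing
      \<open>s\<close> may spoil this, and \<open>y\<close> is the vertex whose removal repairs it.
      With \<open>k\<close> and the partner \<open>z\<close>, exactly three clique vertices are
      gone.\<close>
    obtain y where y: "y \<in> A1" "y \<noteq> u'" "strictly_nested f (A1 - {y}) B1"
      using strictly_nested_repair[OF nest1 fin1(1) u'(1) _ A1(1), of s] u'(2) unfolding B1_def
      by blast
    obtain z where z: "z \<in> A1" "z \<noteq> u'" "z \<noteq> y"
      "ndak_move (split_graph f A1 B1) (split_graph f (A1 - {y, z}) B1)"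
      using ndak_move_clique_pair[where u = u' and f = f, OF disj1 fin1(1) u' y(1,2) A1(2)] by blast
    have "position f (A1 - {y, z}) B1"
      using fin1 disj1 u' y z strictly_nested_subset[OF y(3), of "A1 - {y, z}"]
      by (auto simp: position_def)
    moreover have cA: "card (A1 - {y, z}) = card A - 3"
      using y z fin1 c1 by (simp add: card_Diff_subset)
    moreover have "(card A - 3) mod 3 = 1" using m A4 le_mod_geq[of 3 "card A"] by simp
    moreover have "card B1 \<ge> 3" using c1 position_card_le[OF pos] A4 by simp
    ultimately have "lost f (A1 - {y, z}) B1" "card (A1 - {y, z}) < card A"
      using A4 by (simp_all add: lost_def)
    then show ?thesis using z(4) H1 by blast
  qed
  then show ?thesis using that by blast
qed

text \<open>An instance of \<open>losing_strategy\<close> with the clique size as measure.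
  \<open>L\<close> quantifies over \<open>A\<close> and \<open>B\<close> because the game is played
  on graphs, not on their representations.\<close>

lemma
  assumes "lost f A B"
  shows lost_not_next_wins: "\<not> next_wins ndak_move (split_graph f A B)"
    and lost_option_next_wins: "ndak_move (split_graph f A B) H \<Longrightarrow> next_wins ndak_move H"
proof -
  define L where "L = (\<lambda>n G. \<exists>A B. G = split_graph f A B \<and> lost f A B \<and> n = card A)"
  have reply: "\<exists>k<n. \<exists>z. L k z \<and> ndak_move y z" if L: "L n x" and move: "ndak_move x y" for n x y
  proof -
    obtain A B where x: "x = split_graph f A B" "lost f A B" and n: "n = card A"
      using L unfolding L_def by blast
    obtain A' B' where "lost f A' B'" "card A' < card A" "ndak_move y (split_graph f A' B')"
      using lost_reply[OF x(2)] move x(1) by blast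
    then show ?thesis unfolding L_def n by blast
  qed
  have "L (card A) (split_graph f A B)" using assms by (auto simp: L_def)
  from losing_strategy[of L ndak_move, OF reply this]
  show "\<not> next_wins ndak_move (split_graph f A B)"
    and "ndak_move (split_graph f A B) H \<Longrightarrow> next_wins ndak_move H" by auto
qed

text \<open>From residue 2 the removal of the lowest clique vertex with a neighbour, and from
  residue 0 the removal of a clique pair, brings the size to residue 1. Size at least 4 keeps the
  new clique from being a single vertex, where \<open>lost\<close> also constrains
  \<open>B\<close>.\<close>

lemma next_wins_position_iff:
  assumes pos: "position f A B" and A: "card A \<ge> 4"
  shows "next_wins ndak_move (split_graph f A B) \<longleftrightarrow> card A mod 3 \<noteq> 1"
proof
  assume win: "next_wins ndak_move (split_graph f A B)"
  have "\<not> lost f A B" using lost_not_next_wins win by blast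
  then show "card A mod 3 \<noteq> 1" using pos A by (simp add: lost_def)
next
  assume m: "card A mod 3 \<noteq> 1"
  have arith: "n mod 3 = 2 \<Longrightarrow> (n - 1) mod 3 = 1"
    "n \<ge> 2 \<Longrightarrow> n mod 3 \<noteq> 2 \<Longrightarrow> n mod 3 \<noteq> 1 \<Longrightarrow> (n - 2) mod 3 = 1" for n :: nat
  proof -
    show "n mod 3 = 2 \<Longrightarrow> (n - 1) mod 3 = 1"
      by (cases n) (auto simp: mod_Suc split: if_splits)
    assume "n \<ge> 2"
    then obtain m where "n = Suc (Suc m)" by (metis Suc_le_D numeral_2_eq_2 Suc_le_mono)
    then show "n mod 3 \<noteq> 2 \<Longrightarrow> n mod 3 \<noteq> 1 \<Longrightarrow> (n - 2) mod 3 = 1"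
      by (auto simp: mod_Suc split: if_splits)
  qed
  obtain A' B' where A'B': "lost f A' B'" and
    move: "ndak_move (split_graph f A B) (split_graph f A' B')"
  proof (cases "card A mod 3 = 2")
    case True
    have "card A \<ge> 2" using A by simp
    then obtain A' B' where *: "position f A' B'" "card A' = card A - 1"
      "ndak_move (split_graph f A B) (split_graph f A' B')"
      by (rule position_remove_least[OF pos])
    have "card A' mod 3 = 1" using *(2) arith(1)[OF True] by simp
    moreover have "card A' \<noteq> 1" using *(2) A by simp
    ultimately have "lost f A' B'" using *(1) by (simp add: lost_def)
    then show ?thesis using *(3) that by blast
  next
    case False
    have "card A \<ge> 3" using A by simp
    then obtain A' where *: "position f A' B" "card A' = card A - 2"
      "ndak_move (split_graph f A B) (split_graph f A' B)"
      by (rule position_remove_clique_pair[OF pos])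
    have "card A' mod 3 = 1" using *(2) arith(2)[OF _ False m] A by simp
    moreover have "card A' \<noteq> 1" using *(2) A by simp
    ultimately have "lost f A' B" using *(1) by (simp add: lost_def)
    then show ?thesis using *(3) that by blast
  qed
  from move lost_option_next_wins[OF A'B'] show "next_wins ndak_move (split_graph f A B)"
    by (rule next_wins.intros)
qed

section \<open>Twin-free threshold graphs as positions\<close>

text \<open>Induction along the construction: an isolated vertex has no neighbours, a universal one
  sees all others and joins the neighbourhoods of all old vertices. The first claim is carried along
  because a new vertex must occur in no old edge.\<close>

lemma threshold_graph_neighbours_nested:
  assumes "threshold_graph G"
  shows "\<forall>e \<in> snd G. e \<subseteq> fst G"
    and "u \<in> fst G \<Longrightarrow> v \<in> fst G \<Longrightarrow>
      neighbours G u - {v} \<subseteq> neighbours G v \<or> neighbours G v - {u} \<subseteq> neighbours G u"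
proof -
  have "(\<forall>e \<in> snd G. e \<subseteq> fst G) \<and> (\<forall>u\<in>fst G. \<forall>v\<in>fst G.
      neighbours G u - {v} \<subseteq> neighbours G v \<or> neighbours G v - {u} \<subseteq> neighbours G u)"
    using assms
  proof induction
    case empty
    then show ?case by simp
  next
    case (isolated V E x)
    then have x: "neighbours (insert x V, E) x = {}" and
      V: "neighbours (insert x V, E) u = neighbours (V, E) u" for u
      by (auto simp: neighbours_def)
    show ?case using isolated x V by auto
  next
    case (universal V E x)
    let ?G = "(insert x V, E \<union> {{x, u} | u. u \<in> V})"
    from universal have E: "e \<subseteq> V" if "e \<in> E" for e using that by auto
    have x: "neighbours ?G x = V"
    proof -
      have "{u, x} \<notin> E" for u using E universal.hyps by blast
      then show ?thesis by (auto simp: neighbours_def doubleton_eq_iff)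
    qed
    have V: "neighbours ?G u = insert x (neighbours (V, E) u)" if "u \<in> V" for u
      using that universal.hyps by (auto simp: neighbours_def doubleton_eq_iff)
    have "neighbours (V, E) u \<subseteq> V" for u using E by (auto simp: neighbours_def)
    then have NV: "neighbours (V, E) u - {v} \<subseteq> V" for u v by blast
    have "neighbours ?G u - {v} \<subseteq> neighbours ?G v \<or> neighbours ?G v - {u} \<subseteq> neighbours ?G u"
      if uv: "u \<in> insert x V" "v \<in> insert x V" for u v
    proof (cases "u = x \<or> v = x")
      case True
      then show ?thesis
        using uv x V[of u] V[of v] NV[of u] NV[of v] \<open>\<And>u. neighbours (V, E) u \<subseteq> V\<close> by fastforce
    next
      case False
      then have "neighbours (V, E) u - {v} \<subseteq> neighbours (V, E) v \<or>
          neighbours (V, E) v - {u} \<subseteq> neighbours (V, E) u"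
        using uv universal.IH by auto
      then show ?thesis using V[of u] V[of v] False uv by blast
    qed
    moreover have "\<forall>e\<in>snd ?G. e \<subseteq> fst ?G" using E by auto
    ultimately show ?case by simp
  qed
  then show "\<forall>e \<in> snd G. e \<subseteq> fst G" "u \<in> fst G \<Longrightarrow> v \<in> fst G \<Longrightarrow>
      neighbours G u - {v} \<subseteq> neighbours G v \<or> neighbours G v - {u} \<subseteq> neighbours G u" by auto
qed

lemma simple_graphD:
  assumes "simple_graph G"
  shows "finite (fst G)" and "{u, v} \<in> snd G \<Longrightarrow> u \<in> fst G \<and> v \<in> fst G \<and> u \<noteq> v"
    and "e \<in> snd G \<Longrightarrow> \<exists>u v. e = {u, v}"
proof -
  have G: "finite (fst G)" "snd G \<subseteq> {{u, v} | u v. u \<in> fst G \<and> v \<in> fst G \<and> u \<noteq> v}"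
    using assms by (simp_all add: simple_graph_def case_prod_unfold)
  show "finite (fst G)" by (rule G(1))
  show "{u, v} \<in> snd G \<Longrightarrow> u \<in> fst G \<and> v \<in> fst G \<and> u \<noteq> v"
    using G(2) by (auto simp: doubleton_eq_iff)
  show "e \<in> snd G \<Longrightarrow> \<exists>u v. e = {u, v}" using G(2) by blast
qed

text \<open>Full neighbourhoods can serve as \<open>f\<close>, because \<open>split_graph\<close>
  reads \<open>f a\<close> only on \<open>B\<close>.\<close>

lemma clique_independent_partition_eq_split_graph:
  assumes G: "simple_graph G" and part: "clique_independent_partition G K S"
  shows "G = split_graph (neighbours G) K S"
proof (rule prod_eqI)
  show "fst G = fst (split_graph (neighbours G) K S)"
    using part by (simp add: clique_independent_partition_def)
  have disj: "K \<inter> S = {}" and cl: "\<And>u v. u \<in> K \<Longrightarrow> v \<in> K \<Longrightarrow> u \<noteq> v \<Longrightarrow> {u, v} \<in> snd G"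
    and ind: "\<And>u v. u \<in> S \<Longrightarrow> v \<in> S \<Longrightarrow> {u, v} \<notin> snd G" and V: "fst G = K \<union> S"
    using part by (auto simp: clique_independent_partition_def clique_def independent_def
        split: prod.splits)
  have edge: "{u, v} \<in> snd G \<longleftrightarrow> {u, v} \<in> snd (split_graph (neighbours G) K S)" for u v
  proof -
    have "{u, v} \<in> snd G \<Longrightarrow> u \<in> K \<union> S \<and> v \<in> K \<union> S \<and> u \<noteq> v"
      using simple_graphD(2)[OF G] V by blast
    then show ?thesis
      unfolding edge_split_graph_iff[OF disj] neighbours_def
      using cl ind by (auto simp: insert_commute)
  qed
  show "snd G = snd (split_graph (neighbours G) K S)"
  proof (intro set_eqI iffI)
    fix e assume "e \<in> snd G"
    then show "e \<in> snd (split_graph (neighbours G) K S)"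
      using simple_graphD(3)[OF G] edge by metis
  next
    fix e assume e: "e \<in> snd (split_graph (neighbours G) K S)"
    then obtain u v where "e = {u, v}" by (auto simp: split_graph_def)
    then show "e \<in> snd G" using e edge by simp
  qed
qed

lemma twin_free_threshold_graph_position:
  assumes T: "twin_free_threshold_graph T K S" and K: "card K \<ge> 2"
  shows "T = split_graph (neighbours T) K S" and "position (neighbours T) K S"
proof -
  from T have simple: "simple_graph T" and con: "connected_graph T" and thr: "threshold_graph T"
    and part: "clique_independent_partition T K S" and tf: "twin_free T K"
    and max: "\<And>K' S'. clique_independent_partition T K' S' \<Longrightarrow> \<not> S \<subset> S'"
    by (auto simp: twin_free_threshold_graph_def maximal_partition_def)
  show eq: "T = split_graph (neighbours T) K S"
    using clique_independent_partition_eq_split_graph[OF simple part] .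
  have disj: "K \<inter> S = {}" and V: "fst T = K \<union> S"
    and cl: "\<And>u v. u \<in> K \<Longrightarrow> v \<in> K \<Longrightarrow> u \<noteq> v \<Longrightarrow> {u, v} \<in> snd T"
    and ind: "\<And>u v. u \<in> S \<Longrightarrow> v \<in> S \<Longrightarrow> {u, v} \<notin> snd T"
    using part by (auto simp: clique_independent_partition_def clique_def independent_def
        split: prod.splits)
  have fin: "finite K" "finite S" using simple_graphD(1)[OF simple] V by auto
  have loop: "{k, k} \<notin> snd T" for k using simple_graphD(2)[OF simple] by blast
  have nonempty: "neighbours T k \<inter> S \<noteq> {}" if k: "k \<in> K" for k
  proof
    assume empty: "neighbours T k \<inter> S = {}"
    have "{k, s} \<notin> snd T" "{s, k} \<notin> snd T" if "s \<in> S" for s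
      using that empty by (auto simp: neighbours_def insert_commute)
    \<comment> \<open>A clique vertex without neighbours in \<open>S\<close> could be moved to
      \<open>S\<close>, against maximality.\<close>
    then have "clique_independent_partition T (K - {k}) (insert k S)"
      using part k loop[of k] by (auto simp: clique_independent_partition_def clique_def independent_def
        split: prod.splits)
    then show False using max disj k by blast
  qed
  have distinct: "neighbours T k \<inter> S \<noteq> neighbours T l \<inter> S" if kl: "k \<in> K" "l \<in> K" "k \<noteq> l" for k l
  proof
    assume same: "neighbours T k \<inter> S = neighbours T l \<inter> S"
    \<comment> \<open>Apart from each other, two clique vertices have the same neighbours in
      \<open>K\<close>, so equal traces on \<open>S\<close> would make them twins.\<close>
    have "neighbours T x - {y} = (K - {x, y}) \<union> (neighbours T x \<inter> S)"
      if "x \<in> K" "y \<in> K" for x y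
      using that V cl[of _ x] loop[of x] simple_graphD(2)[OF simple] disj unfolding neighbours_def by blast
    then have "twins T k l" using kl same unfolding twins_def by (simp add: insert_commute)
    then show False using tf kl by (auto simp: twin_free_def)
  qed
  have chain: "neighbours T k \<inter> S \<subseteq> neighbours T l \<inter> S \<or> neighbours T l \<inter> S \<subseteq> neighbours T k \<inter> S"
    if kl: "k \<in> K" "l \<in> K" for k l
    using threshold_graph_neighbours_nested(2)[OF thr, of k l] kl V disj by blast
  have "strictly_nested (neighbours T) K S"
    unfolding strictly_nested_def using nonempty distinct chain by (simp add: psubset_eq)
  moreover from this obtain u where "u \<in> K" "S \<subseteq> neighbours T u"
    using connected_split_graph_cover[of "neighbours T" K S] con eq disj fin K
      strictly_nested_imp_nested by (metis card.empty not_numeral_le_zero)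
  ultimately show "position (neighbours T) K S" using fin disj by (auto simp: position_def)
qed

lemma outcome_ndak:
  assumes "twin_free_threshold_graph T K S" "card K \<ge> 5"
  shows "outcome ndak_move T = outcome (subtraction_move {1, 2}) (card K - 1)"
proof -
  have "next_wins ndak_move T \<longleftrightarrow> card K mod 3 \<noteq> 1"
    using next_wins_position_iff[of "neighbours T" K S] twin_free_threshold_graph_position[OF assms(1)]
      assms(2) by simp
  moreover have "(card K - 1) mod 3 = 0 \<longleftrightarrow> card K mod 3 = 1"
    using assms(2) by (cases "card K") (auto simp: mod_Suc)
  ultimately show ?thesis unfolding outcome_def next_wins_subtraction_12 by simp
qed

section \<open>The clique size in terms of degrees\<close>

definition vertex_degree :: "'a graph \<Rightarrow> 'a \<Rightarrow> nat" where
  "vertex_degree G v = card (neighbours G v)"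

text \<open>Clique vertices have degree at least \<open>|K|\<close>, and together with a neighbour in \<open>S\<close> of the
  lowest clique vertex, which sees all of \<open>K\<close>, this makes \<open>|K| + 1\<close> vertices of degree at least
  \<open>|K|\<close>. All vertices of degree greater than \<open>|K|\<close> lie in \<open>K\<close>.\<close>

lemma card_clique_eq_degree_count:
  assumes T: "twin_free_threshold_graph T K S" and K: "card K \<ge> 2"
  shows "{t \<in> {1..card (fst T)}. card {v \<in> fst T. t \<le> vertex_degree T v} > t} = {1..card K}"
proof -
  from T have simple: "simple_graph T" and part: "clique_independent_partition T K S"
    by (auto simp: twin_free_threshold_graph_def maximal_partition_def)
  have disj: "K \<inter> S = {}" and V: "fst T = K \<union> S"
    and cl: "\<And>u v. u \<in> K \<Longrightarrow> v \<in> K \<Longrightarrow> u \<noteq> v \<Longrightarrow> {u, v} \<in> snd T"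
    and ind: "\<And>u v. u \<in> S \<Longrightarrow> v \<in> S \<Longrightarrow> {u, v} \<notin> snd T"
    using part by (auto simp: clique_independent_partition_def clique_def independent_def
        split: prod.splits)
  have pos: "position (neighbours T) K S" using twin_free_threshold_graph_position[OF T K] by simp
  have fin: "finite K" "finite S" "finite (fst T)" using simple_graphD(1)[OF simple] V by auto
  have nest: "strictly_nested (neighbours T) K S" using pos by (simp add: position_def)
  have nb_fin: "finite (neighbours T v)" for v
    by (rule finite_subset[OF _ fin(3)]) (use simple_graphD(2)[OF simple] in \<open>auto simp: neighbours_def\<close>)
  have degK: "card K \<le> vertex_degree T k" if k: "k \<in> K" for k
  proof -
    obtain s where s: "s \<in> S" "s \<in> neighbours T k" using nest k unfolding strictly_nested_def by blast
    have "insert s (K - {k}) \<subseteq> neighbours T k" using cl[of _ k] k s by (auto simp: neighbours_def)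
    then have "card (insert s (K - {k})) \<le> vertex_degree T k"
      unfolding vertex_degree_def using nb_fin by (rule card_mono[rotated])
    moreover have "card (insert s (K - {k})) = card K"
      using fin disj s(1) k K by (subst card_insert_disjoint) auto
    ultimately show ?thesis by simp
  qed
  have degS: "vertex_degree T s \<le> card K" if s: "s \<in> S" for s
  proof -
    have "neighbours T s \<subseteq> K" using ind[OF _ s] simple_graphD(2)[OF simple] V by (auto simp: neighbours_def)
    then show ?thesis unfolding vertex_degree_def using fin by (simp add: card_mono)
  qed
  have low: "card {v \<in> fst T. t \<le> vertex_degree T v} > t" if t: "t \<le> card K" for t
  proof -
    have "K \<noteq> {}" using K by auto
    then obtain x where x: "x \<in> K" "\<And>a. a \<in> K \<Longrightarrow> neighbours T x \<inter> S \<subseteq> neighbours T a"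
      using nested_least[OF strictly_nested_imp_nested[OF nest] fin(1)] by blast
    obtain s where s: "s \<in> S" "s \<in> neighbours T x" using nest x(1) unfolding strictly_nested_def by blast
    have "K \<subseteq> neighbours T s" using x(2) s by (auto simp: neighbours_def insert_commute)
    then have "card K \<le> vertex_degree T s" unfolding vertex_degree_def using nb_fin by (simp add: card_mono)
    then have "insert s K \<subseteq> {v \<in> fst T. t \<le> vertex_degree T v}"
      using V s(1) t degK by fastforce
    then have "card (insert s K) \<le> card {v \<in> fst T. t \<le> vertex_degree T v}"
      using fin(3) by (intro card_mono) auto
    moreover have "card (insert s K) = Suc (card K)" using fin disj s(1) by (subst card_insert_disjoint) auto
    ultimately show ?thesis using t by simp
  qed
  have high: "card {v \<in> fst T. t \<le> vertex_degree T v} \<le> t" if t: "card K < t" for t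
  proof -
    have "{v \<in> fst T. t \<le> vertex_degree T v} \<subseteq> K" using degS t V by fastforce
    then have "card {v \<in> fst T. t \<le> vertex_degree T v} \<le> card K" using fin by (simp add: card_mono)
    then show ?thesis using t by simp
  qed
  have "card K \<le> card (fst T)" using V fin by (simp add: card_mono)
  then show ?thesis using low high by (auto simp: not_less[symmetric]) 
qed

section \<open>A calculus for running times\<close>

definition runs :: "bool list \<Rightarrow> com \<Rightarrow> (nat \<Rightarrow> nat) \<Rightarrow> nat \<Rightarrow> ((nat \<Rightarrow> nat) \<Rightarrow> bool) \<Rightarrow> bool" where
  "runs w c s T Q \<longleftrightarrow> (\<exists>t s'. exec w c s t s' \<and> t \<le> T \<and> Q s')"

lemma runs_basic:
  "Q (s(i := k)) \<Longrightarrow> runs w (Const i k) s 1 Q"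
  "Q (s(i := s j + s k)) \<Longrightarrow> runs w (Add i j k) s 1 Q"
  "Q (s(i := s j - s k)) \<Longrightarrow> runs w (Sub i j k) s 1 Q"
  "Q (s(i := length w)) \<Longrightarrow> runs w (Len i) s 1 Q"
  "Q (s(i := (if s j < length w \<and> w ! s j then 1 else 0))) \<Longrightarrow> runs w (Read i j) s 1 Q"
  unfolding runs_def by (blast intro: exec.intros)+

lemma runs_Seq: "runs w c1 s T1 (\<lambda>s'. runs w c2 s' T2 Q) \<Longrightarrow> runs w (Seq c1 c2) s (T1 + T2) Q"
  unfolding runs_def by (meson add_le_mono exec.Seq)

lemma runs_IfZero_true: "runs w c1 s T Q \<Longrightarrow> s i = 0 \<Longrightarrow> runs w (IfZero i c1 c2) s (T + 1) Q"
  unfolding runs_def by (meson add_le_mono1 exec.IfZero_true)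

lemma runs_IfZero_false: "runs w c2 s T Q \<Longrightarrow> s i \<noteq> 0 \<Longrightarrow> runs w (IfZero i c1 c2) s (T + 1) Q"
  unfolding runs_def by (meson add_le_mono1 exec.IfZero_false)

lemma runs_mono: "runs w c s T Q \<Longrightarrow> T \<le> T' \<Longrightarrow> (\<And>s. Q s \<Longrightarrow> Q' s) \<Longrightarrow> runs w c s T' Q'"
  unfolding runs_def by (meson order_trans)

text \<open>Applied first, this leaves the time \<open>T\<close> open; the rules for the
  instructions then fill it in as a sum, which is compared with the claimed bound at the
  end.\<close>

lemma runs_le: "runs w c s T Q \<Longrightarrow> T \<le> T' \<Longrightarrow> runs w c s T' Q"
  unfolding runs_def by (meson order_trans)

text \<open>The invariant is indexed by the number of rounds still to go. Each round pays one unit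
  for its test, and the final failing test adds one more.\<close>

lemma runs_WhileNonzero:
  assumes step: "\<And>k s. I (Suc k) s \<Longrightarrow> s i \<noteq> 0 \<and> runs w c s T (I k)"
    and stop: "\<And>s. I 0 s \<Longrightarrow> s i = 0"
    and "I m s"
  shows "runs w (WhileNonzero i c) s (m * (T + 1) + 1) (I 0)"
  using assms(3)
proof (induction m arbitrary: s)
  case 0
  then show ?case using exec.While_stop[of s i w c] stop[of s] by (auto simp: runs_def)
next
  case (Suc m)
  then obtain t1 s1 where 1: "exec w c s t1 s1" "t1 \<le> T" "I m s1" and nz: "s i \<noteq> 0"
    using step[OF Suc.prems] by (auto simp: runs_def)
  then obtain t2 s2 where "exec w (WhileNonzero i c) s1 t2 s2" "t2 \<le> m * (T + 1) + 1" "I 0 s2"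
    using Suc.IH[of s1] by (auto simp: runs_def)
  then show ?case unfolding runs_def using exec.While_step[OF nz 1(1)] 1(2)
    by (intro exI[of _ "t1 + t2 + 1"] exI[of _ s2]) auto
qed

lemmas runs_rules = runs_basic runs_Seq

text \<open>The loop counters run down, so each round extends the counted range at its lower
  end.\<close>

lemma card_filter_atLeastLessThan_rec:
  "k < n \<Longrightarrow> card {x \<in> {k..<n}. P x} = (if P k then 1 else 0) + card {x \<in> {Suc k..<n}. P x}"
proof -
  assume "k < n"
  then have "{x \<in> {k..<n}. P x} = (if P k then {k} else {}) \<union> {x \<in> {Suc k..<n}. P x}"
    by (auto simp: Suc_le_eq le_less)
  then show ?thesis by (simp add: card_insert_if)
qed

lemma card_filter_greaterThanAtMost_rec:
  "k < n \<Longrightarrow> card {x \<in> {k<..n}. P x} = (if P (Suc k) then 1 else 0) + card {x \<in> {Suc k<..n}. P x}"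
proof -
  assume "k < n"
  then have "{x \<in> {k<..n}. P x} = (if P (Suc k) then {Suc k} else {}) \<union> {x \<in> {Suc k<..n}. P x}" 
    by (auto simp: Suc_le_eq) (metis Suc_lessI)
  then show ?thesis by (simp add: card_insert_if)
qed

section \<open>The program, its invariants and its running time\<close>

text \<open>Register 0 starts at 2 and is incremented modulo 3, so that it ends as \<open>(|K| - 1) mod 3\<close>;
  1, 10 and 13 hold the constants 1, 3 and 0; 2 holds the number \<open>n\<close> of vertices; 3, 4 and 6 are
  loop counters running down to 0; 5 and 7 count vertices of large degree and neighbours; 8 is the
  position in the adjacency matrix, which is read backwards. The input has length \<open>n\<^sup>2\<close>, and \<open>n\<close> is
  found by subtracting the odd numbers in 12 from 11.\<close>

definition skip :: com where "skip = Const 9 0"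

definition sqrt_body :: com where
  "sqrt_body = Seq (Sub 11 11 12) (Seq (Add 12 12 1) (Seq (Add 12 12 1) (Add 2 2 1)))"

definition entry_body :: com where
  "entry_body = Seq (Sub 8 8 1) (Seq (Read 9 8) (Seq (Add 7 7 9) (Sub 6 6 1)))"

definition row_body :: com where
  "row_body = Seq (Add 6 2 13) (Seq (Const 7 0) (Seq (WhileNonzero 6 entry_body)
     (Seq (Sub 9 3 7) (Seq (IfZero 9 (Add 5 5 1) skip) (Sub 4 4 1)))))"

definition threshold_body :: com where
  "threshold_body = Seq (Add 4 2 13) (Seq (Const 5 0) (Seq (Len 8) (Seq (WhileNonzero 4 row_body)
     (Seq (Sub 9 5 3) (Seq
       (IfZero 9 skip (Seq (Add 0 0 1) (Seq (Sub 9 10 0) (IfZero 9 (Const 0 0) skip))))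
       (Sub 3 3 1))))))"

definition degree_count_program :: com where
  "degree_count_program =
     Seq (Const 1 1) (Seq (Const 10 3) (Seq (Const 0 2) (Seq (Len 11) (Seq (Const 12 1)
     (Seq (WhileNonzero 11 sqrt_body) (Seq (Add 3 2 13)
     (Seq (WhileNonzero 3 threshold_body) (IfZero 0 skip (Const 0 1)))))))))"

definition row_count :: "nat \<Rightarrow> (nat \<Rightarrow> nat \<Rightarrow> bool) \<Rightarrow> nat \<Rightarrow> nat" where
  "row_count n a i = card {j \<in> {0..<n}. a i j}"

definition threshold_count :: "nat \<Rightarrow> (nat \<Rightarrow> nat \<Rightarrow> bool) \<Rightarrow> nat \<Rightarrow> nat" where
  "threshold_count n a t = card {i \<in> {0..<n}. t \<le> row_count n a i}"

context
  fixes w :: "bool list" and n :: nat and a :: "nat \<Rightarrow> nat \<Rightarrow> bool"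
  assumes len: "length w = n * n"
    and nth: "\<And>i j. i < n \<Longrightarrow> j < n \<Longrightarrow> w ! (i * n + j) \<longleftrightarrow> a i j"
begin

text \<open>Register 9 is scratch and occurs in no invariant, which is why \<open>skip\<close> may
  overwrite it.\<close>

definition base :: "(nat \<Rightarrow> nat) \<Rightarrow> bool" where
  "base s \<longleftrightarrow> s 1 = 1 \<and> s 10 = 3 \<and> s 13 = 0"

text \<open>After \<open>j\<close> rounds register 11 holds \<open>n * n - j * j\<close>, written
  additively to avoid truncation, and register 12 the next odd number \<open>2 * j + 1\<close>, the
  gap between consecutive squares.\<close>

definition sqrt_inv :: "nat \<Rightarrow> (nat \<Rightarrow> nat) \<Rightarrow> bool" where
  "sqrt_inv k s \<longleftrightarrow> base s \<and> s 0 = 2 \<and> k \<le> n \<and> s 2 + k = n \<and>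
     s 11 + s 2 * s 2 = n * n \<and> s 12 = 2 * s 2 + 1"

text \<open>The parameters \<open>r\<close>, \<open>t\<close> and \<open>c\<close> freeze the
  registers of the outer loops. Registers 4 and 8 are one ahead of the current row and of the next
  entry, since they are decremented after the row and before the read, respectively.\<close>

definition entry_inv :: "nat \<Rightarrow> nat \<Rightarrow> nat \<Rightarrow> nat \<Rightarrow> nat \<Rightarrow> (nat \<Rightarrow> nat) \<Rightarrow> bool" where
  "entry_inv r t c i k s \<longleftrightarrow> base s \<and> s 2 = n \<and> s 0 = r \<and> s 3 = t \<and> s 4 = Suc i \<and> s 5 = c \<and>
     s 6 = k \<and> s 7 = card {j \<in> {k..<n}. a i j} \<and> s 8 = i * n + k \<and> k \<le> n"

definition row_inv :: "nat \<Rightarrow> nat \<Rightarrow> nat \<Rightarrow> (nat \<Rightarrow> nat) \<Rightarrow> bool" where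
  "row_inv r t k s \<longleftrightarrow> base s \<and> s 2 = n \<and> s 0 = r \<and> s 3 = t \<and> s 4 = k \<and>
     s 5 = card {i \<in> {k..<n}. t \<le> row_count n a i} \<and> s 8 = k * n \<and> k \<le> n"

definition threshold_inv :: "nat \<Rightarrow> (nat \<Rightarrow> nat) \<Rightarrow> bool" where
  "threshold_inv k s \<longleftrightarrow> base s \<and> s 2 = n \<and> s 3 = k \<and> k \<le> n \<and>
     s 0 = (card {t \<in> {k<..n}. threshold_count n a t > t} + 2) mod 3"

lemma runs_sqrt_body:
  assumes "sqrt_inv (Suc k) s"
  shows "s 11 \<noteq> 0 \<and> runs w sqrt_body s 4 (sqrt_inv k)"
proof -
  have n: "n = s 2 + Suc k" using assms by (simp add: sqrt_inv_def)
  have "s 11 + s 2 * s 2 = n * n" using assms by (simp add: sqrt_inv_def)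
  \<comment> \<open>In this form register 11 is visibly at least \<open>2 * s 2 + 1\<close>, so the
    truncated subtraction is exact.\<close>
  then have 11: "s 11 = 2 * s 2 * Suc k + Suc k * Suc k" unfolding n by (simp add: algebra_simps)
  have "runs w sqrt_body s 4 (sqrt_inv k)"
    unfolding sqrt_body_def
    apply (rule runs_le)
      apply (rule runs_rules)+
    using assms 11 apply (simp_all add: sqrt_inv_def base_def algebra_simps)
    done
  then show ?thesis using 11 by simp
qed

lemma runs_entry_body:
  assumes "entry_inv r t c i (Suc k) s" and i: "i < n"
  shows "s 6 \<noteq> 0 \<and> runs w entry_body s 4 (entry_inv r t c i k)"
proof -
  have k: "k < n" using assms(1) by (simp add: entry_inv_def)
  \<comment> \<open>The read position lies inside the input, so the default 0 for positions beyond
    its end does not occur.\<close>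
  have "i * n + k < Suc i * n" using k by simp
  also have "\<dots> \<le> n * n" using i by (intro mult_right_mono) auto
  finally have "i * n + k < length w" by (simp add: len)
  moreover have "w ! (i * n + k) = a i k" using nth[OF i k] .
  ultimately have "runs w entry_body s 4 (entry_inv r t c i k)"
    unfolding entry_body_def
    apply -
    apply (rule runs_le)
      apply (rule runs_rules)+
    using assms(1) card_filter_atLeastLessThan_rec[OF k, of "a i"]
     apply (simp_all add: entry_inv_def base_def)
    done
  then show ?thesis using assms(1) by (simp add: entry_inv_def)
qed

lemma runs_row_body:
  assumes "row_inv r t (Suc k) s"
  shows "s 4 \<noteq> 0 \<and> runs w row_body s (5 * n + 7) (row_inv r t k)"
proof -
  have k: "k < n" using assms by (simp add: row_inv_def)
  have loop: "runs w (WhileNonzero 6 entry_body) s' (n * (4 + 1) + 1) (entry_inv r t c k 0)"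
    if "entry_inv r t c k n s'" for s' c
    using that by (intro runs_WhileNonzero[where I = "entry_inv r t c k"] runs_entry_body k)
      (auto simp: entry_inv_def)
  let ?c = "card {i \<in> {Suc k..<n}. t \<le> row_count n a i}"
  have rest: "runs w (Seq (Sub 9 3 7) (Seq (IfZero 9 (Add 5 5 1) skip) (Sub 4 4 1))) s' 4
      (row_inv r t k)" if "entry_inv r t ?c k 0 s'" for s'
  proof -
    have s': "base s'" "s' 2 = n" "s' 0 = r" "s' 3 = t" "s' 4 = Suc k" "s' 5 = ?c"
      "s' 7 = row_count n a k" "s' 8 = k * n"
      using that by (simp_all add: entry_inv_def row_count_def)
    note c = card_filter_atLeastLessThan_rec[OF k, of "\<lambda>i. t \<le> row_count n a i"]
    show ?thesis
    proof (cases "t \<le> row_count n a k")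
      case True
      show ?thesis
        by (rule runs_le, (rule runs_rules runs_IfZero_true)+)
          (use True s' c k in \<open>simp_all add: row_inv_def base_def\<close>)
    next
      case False
      show ?thesis
        unfolding skip_def
        by (rule runs_le, (rule runs_rules runs_IfZero_false)+)
          (use False s' c k in \<open>simp_all add: row_inv_def base_def\<close>)
    qed
  qed
  \<comment> \<open>The bound adds up as 2 for the initialisations, \<open>5 * n + 1\<close> for the
    loop and 4 for the rest.\<close>
  have "runs w row_body s (5 * n + 7) (row_inv r t k)"
    unfolding row_body_def
    apply (rule runs_le)
      apply (rule runs_rules)+
      apply (rule runs_mono[OF loop[of ?c] order_refl])
    using assms apply (simp add: entry_inv_def row_inv_def base_def)
      apply (erule rest)
    apply simp
    done
  then show ?thesis using assms by (simp add: row_inv_def)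
qed

lemma runs_threshold_body:
  assumes "threshold_inv (Suc k) s"
  shows "s 3 \<noteq> 0 \<and> runs w threshold_body s (n * (5 * n + 8) + 11) (threshold_inv k)"
proof -
  have k: "k < n" using assms by (simp add: threshold_inv_def)
  have loop: "runs w (WhileNonzero 4 row_body) s' (n * (5 * n + 7 + 1) + 1) (row_inv r (Suc k) 0)"
    if "row_inv r (Suc k) n s'" for s' r
    using that by (intro runs_WhileNonzero[where I = "row_inv r (Suc k)"] runs_row_body)
      (auto simp: row_inv_def)
  let ?r = "(card {t \<in> {Suc k<..n}. threshold_count n a t > t} + 2) mod 3"
  have rest: "runs w (Seq (Sub 9 5 3) (Seq
       (IfZero 9 skip (Seq (Add 0 0 1) (Seq (Sub 9 10 0) (IfZero 9 (Const 0 0) skip))))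
       (Sub 3 3 1))) s' 7 (threshold_inv k)" if "row_inv ?r (Suc k) 0 s'" for s'
  proof -
    define M where "M = card {t \<in> {Suc k<..n}. threshold_count n a t > t}"
    define x where "x = (M + 2) mod 3"
    have "x < 3" by (simp add: x_def)
    have s': "base s'" "s' 2 = n" "s' 0 = x" "s' 3 = Suc k" "s' 5 = threshold_count n a (Suc k)"
      using that by (simp_all add: row_inv_def threshold_count_def x_def M_def)
    have c: "(card {t \<in> {k<..n}. threshold_count n a t > t} + 2) mod 3 =
        (if Suc k < threshold_count n a (Suc k) then (if x = 2 then 0 else Suc x) else x)"
    proof -
      have "M mod 3 = 0 \<or> M mod 3 = 1 \<or> M mod 3 = 2" by linarith
      then show ?thesis
        unfolding card_filter_greaterThanAtMost_rec[OF k, of "\<lambda>t. threshold_count n a t > t"]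
          x_def M_def[symmetric]
        by (auto simp: mod_Suc)
    qed
    \<comment> \<open>These are the branches of the code: no increment, an increment to 3 that is
      reset to 0, and a plain increment. Register 9 holds \<open>3 - s 0\<close>, which vanishes
      exactly in the second.\<close>
    consider "\<not> Suc k < threshold_count n a (Suc k)" | "Suc k < threshold_count n a (Suc k)" "x = 2"
      | "Suc k < threshold_count n a (Suc k)" "x < 2"
      using \<open>x < 3\<close> by linarith
    then show ?thesis
    proof cases
      case 1
      show ?thesis
        unfolding skip_def
        by (rule runs_le, (rule runs_rules runs_IfZero_true)+)
          (use 1 s' c k in \<open>simp_all add: threshold_inv_def base_def\<close>)
    next
      case 2
      show ?thesis
        by (rule runs_le, (rule runs_rules)+, rule runs_IfZero_false, (rule runs_rules runs_IfZero_true)+)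
          (use 2 s' c k in \<open>simp_all add: threshold_inv_def base_def\<close>)
    next
      case 3
      show ?thesis
        unfolding skip_def
        by (rule runs_le, (rule runs_rules runs_IfZero_false)+)
          (use 3 s' c k in \<open>simp_all add: threshold_inv_def base_def\<close>)
    qed
  qed
  have "runs w threshold_body s (n * (5 * n + 8) + 11) (threshold_inv k)"
    unfolding threshold_body_def
    apply (rule runs_le)
      apply (rule runs_rules)+
      apply (rule runs_mono[OF loop[of ?r] order_refl])
    using assms apply (simp add: threshold_inv_def row_inv_def base_def len)
      apply (erule rest)
    apply simp
    done
  then show ?thesis using assms by (simp add: threshold_inv_def)
qed

lemma runs_degree_count_program:
  "runs w degree_count_program (\<lambda>_. 0) (n * (n * (5 * n + 8) + 17) + 11)
     (\<lambda>s. s 0 = (if card {t \<in> {1..n}. threshold_count n a t > t} mod 3 = 1 then 0 else 1))"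
proof -
  let ?Q = "\<lambda>s :: nat \<Rightarrow> nat. s 0 = (if card {t \<in> {1..n}. threshold_count n a t > t} mod 3 = 1 then 0 else 1)"
  have loop1: "runs w (WhileNonzero 11 sqrt_body) s' (n * (4 + 1) + 1) (sqrt_inv 0)"
    if "sqrt_inv n s'" for s'
    using that by (intro runs_WhileNonzero[where I = sqrt_inv] runs_sqrt_body) (auto simp: sqrt_inv_def)
  have loop2: "runs w (WhileNonzero 3 threshold_body) s' (n * (n * (5 * n + 8) + 11 + 1) + 1) (threshold_inv 0)"
    if "threshold_inv n s'" for s'
    using that by (intro runs_WhileNonzero[where I = threshold_inv] runs_threshold_body) (auto simp: threshold_inv_def)
  have range: "{0<..n} = {1..n}" by auto
  have rest: "runs w (IfZero 0 skip (Const 0 1)) s' 2 ?Q" if "threshold_inv 0 s'" for s'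
  proof -
    \<comment> \<open>Register 0 holds the count plus 2 modulo 3; the last instruction turns a
      nonzero residue into 1.\<close>
    have "s' 0 = 0 \<longleftrightarrow> card {t \<in> {1..n}. threshold_count n a t > t} mod 3 = 1"
      using that unfolding threshold_inv_def range by (simp add: mod_Suc)
    moreover have "runs w skip s' 1 (\<lambda>s. s 0 = s' 0)"
      unfolding skip_def by (rule runs_basic) simp
    moreover have "runs w (Const 0 1) s' 1 (\<lambda>s. s 0 = 1)"
      by (rule runs_basic) simp
    ultimately show ?thesis
      using runs_IfZero_true[of w skip s' 1 ?Q 0 "Const 0 1"]
        runs_IfZero_false[of w "Const 0 1" s' 1 ?Q 0 skip]
      by (cases "s' 0 = 0") (auto simp: numeral_2_eq_2)
  qed
  have middle: "runs w (Seq (Add 3 2 13) (Seq (WhileNonzero 3 threshold_body)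
      (IfZero 0 skip (Const 0 1)))) s' (1 + (n * (n * (5 * n + 8) + 11 + 1) + 1 + 2)) ?Q" if "sqrt_inv 0 s'" for s'
    apply (rule runs_rules)+
    apply (rule runs_mono[OF loop2 order_refl])
    using that apply (simp add: threshold_inv_def sqrt_inv_def base_def)
    apply (erule rest)
    done
  show ?thesis
    unfolding degree_count_program_def
    apply (rule runs_le)
      apply (rule runs_rules)+
      apply (rule runs_mono[OF loop1 order_refl])
       apply (simp add: sqrt_inv_def base_def len)
      apply (erule middle)
    apply (simp add: algebra_simps)
    done
qed

end

section \<open>Adjacency matrices and polynomial time\<close>

text \<open>Row-major indexing. The number of rows \<open>m\<close> is separate from the row length
  \<open>n\<close> because the induction adds one row at a time.\<close>

lemma concat_map_upt:
  fixes g :: "nat \<Rightarrow> nat \<Rightarrow> 'b"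
  shows "length (concat (map (\<lambda>i. map (g i) [0..<n]) [0..<m])) = m * n"
    and "i < m \<Longrightarrow> j < n \<Longrightarrow> concat (map (\<lambda>i. map (g i) [0..<n]) [0..<m]) ! (i * n + j) = g i j"
proof -
  show len: "length (concat (map (\<lambda>i. map (g i) [0..<n]) [0..<m])) = m * n" for m
    by (induction m) auto
  show "i < m \<Longrightarrow> j < n \<Longrightarrow> concat (map (\<lambda>i. map (g i) [0..<n]) [0..<m]) ! (i * n + j) = g i j"
  proof (induction m)
    case (Suc m)
    show ?case
    proof (cases "i = m")
      case True
      then show ?thesis using Suc.prems len[of m] by (simp add: nth_append)
    next
      case False
      then have "i < m" using Suc.prems by simp
      have "i * n + j < Suc i * n" using Suc.prems by simp
      also have "\<dots> \<le> m * n" using \<open>i < m\<close> by (intro mult_right_mono) auto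
      finally have "i * n + j < m * n" .
      then show ?thesis using Suc \<open>i < m\<close> len[of m] by (simp add: nth_append)
    qed
  qed simp
qed

text \<open>The partition is not part of the input; \<open>card_clique_eq_degree_count\<close>
  recovers \<open>card K\<close> from the degrees, and the outcome depends only on its residue
  modulo 3.\<close>

lemma poly_time_outcome_ndak:
  "poly_time_computable_on adjacency_matrix
     {T :: nat graph. (\<exists>N. fst T = {0..<N}) \<and>
        (\<exists>K S. twin_free_threshold_graph T K S \<and> card K \<ge> 5)}
     (\<lambda>T. outcome_code (outcome ndak_move T))"
  unfolding poly_time_computable_on_def
\<comment> \<open>The coefficients are those of the bound
  \<open>n * (n * (5 * n + 8) + 17) + 11\<close>.\<close>
proof (rule exI[of _ degree_count_program], rule exI[of _ "[:11, 17, 8, 5:]"], rule ballI)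
  fix T :: "nat graph"
  assume "T \<in> {T. (\<exists>N. fst T = {0..<N}) \<and> (\<exists>K S. twin_free_threshold_graph T K S \<and> card K \<ge> 5)}"
  then obtain N K S where V: "fst T = {0..<N}" and T: "twin_free_threshold_graph T K S"
    and K: "card K \<ge> 5" by auto
  let ?w = "adjacency_matrix T" and ?a = "\<lambda>i j. {i, j} \<in> snd T"
  let ?p = "[:11, 17, 8, 5:] :: nat poly"
  have w: "?w = concat (map (\<lambda>i. map (?a i) [0..<N]) [0..<N])"
    using V by (simp add: adjacency_matrix_def Let_def)
  have len: "length ?w = N * N" and nth: "\<And>i j. i < N \<Longrightarrow> j < N \<Longrightarrow> ?w ! (i * N + j) \<longleftrightarrow> ?a i j"
    unfolding w by (rule concat_map_upt; assumption)+
  have "row_count N ?a v = vertex_degree T v" if "v \<in> fst T" for v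
  proof -
    have "{j \<in> {0..<N}. {v, j} \<in> snd T} = neighbours T v"
      using T V by (auto simp: neighbours_def insert_commute twin_free_threshold_graph_def
        dest: simple_graphD(2))
    then show ?thesis by (simp add: row_count_def vertex_degree_def)
  qed
  then have "threshold_count N ?a t = card {v \<in> fst T. t \<le> vertex_degree T v}" for t
    unfolding threshold_count_def V[symmetric] by (intro arg_cong[where f = card]) auto
  then have "{t \<in> {1..N}. threshold_count N ?a t > t} = {1..card K}"
    using card_clique_eq_degree_count[OF T] K V by simp
  moreover have "(card K - 1) mod 3 = 0 \<longleftrightarrow> card K mod 3 = 1"
    using K by (cases "card K") (auto simp: mod_Suc)
  ultimately have out: "outcome_code (outcome ndak_move T) =
      (if card {t \<in> {1..N}. threshold_count N ?a t > t} mod 3 = 1 then 0 else 1)"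
    unfolding outcome_ndak[OF T K] unfolding outcome_def next_wins_subtraction_12 by simp
  \<comment> \<open>The polynomial is evaluated at the input length \<open>N * N\<close>, while the
    program is bounded in terms of \<open>N\<close>; monotonicity bridges the two.\<close>
  have le: "N \<le> N * N" by (rule le_square)
  have "N * (N * (5 * N + 8) + 17) + 11 \<le> (N * N) * ((N * N) * (5 * (N * N) + 8) + 17) + 11"
    by (intro add_mono mult_mono le order_refl) auto
  also have "\<dots> = poly ?p (length ?w)" unfolding len by (simp add: algebra_simps)
  finally have bound: "N * (N * (5 * N + 8) + 17) + 11 \<le> poly ?p (length ?w)" .
  have "runs ?w degree_count_program (\<lambda>_. 0) (N * (N * (5 * N + 8) + 17) + 11)
      (\<lambda>s. s 0 = outcome_code (outcome ndak_move T))"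
    unfolding out by (rule runs_degree_count_program[OF len nth])
  then show "\<exists>t s. exec ?w degree_count_program (\<lambda>_. 0) t s \<and>
      s 0 = outcome_code (outcome ndak_move T) \<and> t \<le> poly ?p (length ?w)"
    unfolding runs_def using bound by (meson order_trans)
qed

theorem theorem8:
  shows "(\<forall>(T :: 'a graph) K S.
            twin_free_threshold_graph T K S \<and> card K \<ge> 5 \<longrightarrow>
              outcome ndak_move T = outcome (subtraction_move {1, 2}) (card K - 1))
       \<and> poly_time_computable_on adjacency_matrix
           {T :: nat graph. (\<exists>N. fst T = {0..<N}) \<and>
              (\<exists>K S. twin_free_threshold_graph T K S \<and> card K \<ge> 5)}
           (\<lambda>T. outcome_code (outcome ndak_move T))"
  using outcome_ndak poly_time_outcome_ndak by blast

end
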